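(* For every dimension $d\ge 1$ there exists a quantity $c_d>0$ (depending only on $d$) such that for every integer $N\ge 1$ every $N$-element point set $\mathcal{P}$ in the unit cube $[0,1)^d$ has extreme $L_2$ discrepancy bounded by $$L_{2,N}^{\mathrm{extr}}(\mathcal{P}) \ge c_d\,(1+\log N)^{\frac{d-1}{2}}.$$
   Context: Let $\mathcal{P}=\{\boldsymbol{x}_0,\dots,\boldsymbol{x}_{N-1}\}$ be an $N$-element point set in $[0,1)^d$. For measurable $B\subseteq[0,1]^d$ let $A(B,\mathcal{P})=|\{n\in\{0,\dots,N-1\}: \boldsymbol{x}_n\in B\}|$, and let $\lambda$ be Lebesgue measure. For $\boldsymbol{x}=(x_1,\dots,x_d)$ and $\boldsymbol{y}=(y_1,\dots,y_d)$ in $[0,1]^d$, $\boldsymbol{x}\le\boldsymbol{y}$ means $x_i\le y_i$ for all $i$, and then $[\boldsymbol{x},\boldsymbol{y})=\prod_{i=1}^d[x_i,y_i)$. Extreme $L_2$ discrepancy: $$L_{2,N}^{\mathrm{extr}}(\mathcal{P})=\left(\int_{[0,1]^d}\int_{[0,1]^d,\ \boldsymbol{x}\le\boldsymbol{y}}|A([\boldsymbol{x},\boldsymbol{y}),\mathcal{P})-N\lambda([\boldsymbol{x},\boldsymbol{y}))|^2\,\mathrm{d}\boldsymbol{x}\,\mathrm{d}\boldsymbol{y}\right)^{1/2}.$$ *)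

theory Defs
  imports "HOL-Analysis.Analysis"
begin

definition half_open_box :: "real ^ 'd \<Rightarrow> real ^ 'd \<Rightarrow> (real ^ 'd) set" where
  "half_open_box x y = {z. \<forall>i. x $ i \<le> z $ i \<and> z $ i < y $ i}"

text \<open>The points \<open>x\<^sub>0, \<dots>, x\<^bsub>N-1\<^esub>\<close> of an \<open>N\<close>-element set are distinct, so the number of
  indices \<open>n < N\<close> with \<open>x\<^sub>n \<in> B\<close> is the number of elements of \<open>P\<close> in \<open>B\<close>.\<close>

definition count_in :: "(real ^ 'd) set \<Rightarrow> (real ^ 'd) set \<Rightarrow> nat" where
  "count_in B P = card {p \<in> P. p \<in> B}"

text \<open>Here \<open>N = card P\<close>, and \<open>x \<le> y\<close> is the componentwise order on vectors. For finite \<open>P\<close> the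
  integrand is Borel measurable and bounded, so the iterated Bochner integral is the
  true (finite) value of the double integral.\<close>

definition extreme_L2_discrepancy :: "(real ^ 'd) set \<Rightarrow> real" where
  "extreme_L2_discrepancy P = sqrt (
     LBINT y:cbox 0 1. LBINT x:{x \<in> cbox 0 1. x \<le> y}.
       \<bar>real (count_in (half_open_box x y) P)
          - real (card P) * measure lborel (half_open_box x y)\<bar>\<^sup>2)"

end

theory Submission
  imports Defs
begin

text \<open>
  Roth's orthogonal function method. For fixed \<open>y \<in> [1/2,1]\<^sup>d\<close>, consider
  \<open>x \<mapsto> A([x,y),P) - N \<lambda>([x,y))\<close> on \<open>[0,1/2)\<^sup>d\<close>. A product of Haar functions supported on a dyadic
  box \<open>R\<close> that contains no point of \<open>P\<close> is orthogonal to the counting part, whatever \<open>y\<close> is, and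
  its inner product with the volume part is \<open>-4\<^bsup>-d\<^esup> N |R|\<^sup>2\<close>. For volumes comparable to
  \<open>1/N\<close>, at least half of the boxes of each shape are empty, and the number of shapes is at least
  of order \<open>(1 + log N)\<^bsup>d-1\<^esup>\<close>; Bessel's inequality then bounds the integral of the square over \<open>x\<close>
  from below by a multiple of \<open>(1 + log N)\<^bsup>d-1\<^esup>\<close>, uniformly in \<open>y\<close>.
\<close>

section \<open>Integrals of products of one-variable functions on \<open>real ^ 'd\<close>\<close>

text \<open>Lebesgue measure on a Euclidean space is built from coordinates indexed by
  \<open>Basis\<close>. This reindexing along \<open>i \<mapsto> axis i 1\<close> translates them
  into the components \<open>x $ i\<close>.\<close>

lemma cart_prod_Basis:
  fixes g :: "'d::finite \<Rightarrow> real \<Rightarrow> real" and x :: "real ^ 'd"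
  shows "(\<Prod>b\<in>Basis. g (inv (\<lambda>i. axis i (1::real)) b) (x \<bullet> b)) = (\<Prod>i\<in>UNIV. g i (x $ i))"
proof -
  have inj: "inj (\<lambda>i::'d. axis i (1::real))" by (auto simp: inj_def axis_eq_axis)
  have B: "(Basis :: (real^'d) set) = range (\<lambda>i. axis i 1)" by (auto simp: Basis_vec_def)
  show ?thesis unfolding B
    by (subst prod.reindex[OF inj]) (simp add: inv_f_f[OF inj] inner_axis)
qed

text \<open>By \<open>lborel_eq\<close>, \<open>lborel\<close> is the image under \<open>?T\<close>
  of a product of copies of one-dimensional Lebesgue measure. After this change of variables the
  integrand is a product over \<open>Basis\<close>, and Fubini for finite products applies.\<close>

lemma
  fixes g :: "'d::finite \<Rightarrow> real \<Rightarrow> real"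
  assumes g: "\<And>i. integrable lborel (g i)"
  shows integrable_lborel_cart_prod:
      "integrable lborel (\<lambda>x::real^'d. \<Prod>i\<in>UNIV. g i (x $ i))" (is "integrable _ ?G")
    and integral_lborel_cart_prod:
      "(\<integral>x. (\<Prod>i\<in>UNIV. g i (x $ i)) \<partial>(lborel :: (real^'d) measure)) = (\<Prod>i\<in>UNIV. \<integral>t. g i t \<partial>lborel)"
proof -
  let ?e = "\<lambda>i::'d. axis i (1::real)"
  let ?B = "Basis :: (real^'d) set"
  let ?T = "\<lambda>f. \<Sum>b\<in>?B. f b *\<^sub>R b"
  have inj: "inj ?e" by (auto simp: inj_def axis_eq_axis)
  have B: "?B = range ?e" by (auto simp: Basis_vec_def)
  interpret product_sigma_finite "\<lambda>b::real^'d. lborel :: real measure" ..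
  have gB: "integrable lborel (g (inv ?e b))" for b using g .
  have gm[measurable]: "g i \<in> borel_measurable borel" for i using g[of i] by simp
  have GT: "?G (?T f) = (\<Prod>b\<in>?B. g (inv ?e b) (f b))" for f
    by (subst cart_prod_Basis[symmetric]) simp
  have T[measurable]: "?T \<in> (\<Pi>\<^sub>M b\<in>?B. lborel) \<rightarrow>\<^sub>M borel" by measurable
  have G[measurable]: "?G \<in> borel_measurable borel" by measurable
  have "integrable (\<Pi>\<^sub>M b\<in>?B. lborel) (\<lambda>f. ?G (?T f))"
    unfolding GT by (rule product_integrable_prod) (use gB in auto)
  then show "integrable lborel ?G"
    by (subst lborel_eq) (simp add: integrable_distr_eq)
  have "(\<integral>x. ?G x \<partial>lborel) = (\<integral>f. ?G (?T f) \<partial>(\<Pi>\<^sub>M b\<in>?B. lborel))"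
    by (subst lborel_eq) (simp add: integral_distr)
  also have "\<dots> = (\<Prod>b\<in>?B. \<integral>t. g (inv ?e b) t \<partial>lborel)"
    unfolding GT by (rule product_integral_prod) (use gB in auto)
  also have "\<dots> = (\<Prod>i\<in>UNIV. \<integral>t. g i t \<partial>lborel)"
    unfolding B by (subst prod.reindex[OF inj]) (simp add: inv_f_f[OF inj])
  finally show "(\<integral>x. ?G x \<partial>lborel) = (\<Prod>i\<in>UNIV. \<integral>t. g i t \<partial>lborel)" .
qed

section \<open>Bessel's inequality for orthogonal systems\<close>

text \<open>Expand the nonnegative integral of
  \<open>(f - (\<Sum>j\<in>J. c j * e j))\<^sup>2\<close>, where the \<open>c j\<close> are the
  Fourier coefficients. The system is orthogonal but not normalised, hence the division by the
  squared norms.\<close>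

lemma bessel_inequality:
  fixes f :: "'a \<Rightarrow> real" and e :: "'j \<Rightarrow> 'a \<Rightarrow> real"
  assumes "finite J"
    and ff: "integrable M (\<lambda>x. (f x)\<^sup>2)"
    and fe: "\<And>j. j \<in> J \<Longrightarrow> integrable M (\<lambda>x. f x * e j x)"
    and ee: "\<And>i j. i \<in> J \<Longrightarrow> j \<in> J \<Longrightarrow> integrable M (\<lambda>x. e i x * e j x)"
    and orth: "\<And>i j. i \<in> J \<Longrightarrow> j \<in> J \<Longrightarrow> i \<noteq> j \<Longrightarrow> (\<integral>x. e i x * e j x \<partial>M) = 0"
  shows "(\<Sum>j\<in>J. (\<integral>x. f x * e j x \<partial>M)\<^sup>2 / (\<integral>x. e j x * e j x \<partial>M)) \<le> (\<integral>x. (f x)\<^sup>2 \<partial>M)"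
proof -
  let ?a = "\<lambda>j. \<integral>x. f x * e j x \<partial>M"
  let ?w = "\<lambda>j. \<integral>x. e j x * e j x \<partial>M"
  define c where "c j = ?a j / ?w j" for j
  have expand: "(f x - (\<Sum>j\<in>J. c j * e j x))\<^sup>2
      = (f x)\<^sup>2 - 2 * (\<Sum>j\<in>J. c j * (f x * e j x)) + (\<Sum>i\<in>J. \<Sum>j\<in>J. c i * c j * (e i x * e j x))" for x
    by (simp add: power2_diff power2_eq_square[of "sum _ _"] sum_product sum_distrib_left algebra_simps)
  have "0 \<le> (\<integral>x. (f x - (\<Sum>j\<in>J. c j * e j x))\<^sup>2 \<partial>M)" by simp
  also have "\<dots> = (\<integral>x. (f x)\<^sup>2 \<partial>M) - 2 * (\<Sum>j\<in>J. c j * ?a j) + (\<Sum>i\<in>J. \<Sum>j\<in>J. c i * c j * (\<integral>x. e i x * e j x \<partial>M))"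
    unfolding expand using ff fe ee
    by (subst Bochner_Integration.integral_add Bochner_Integration.integral_diff integral_mult_right_zero Bochner_Integration.integral_sum
      | auto intro!: Bochner_Integration.integrable_sum Bochner_Integration.integrable_diff sum.cong)+
  also have "(\<Sum>i\<in>J. \<Sum>j\<in>J. c i * c j * (\<integral>x. e i x * e j x \<partial>M)) = (\<Sum>i\<in>J. \<Sum>j\<in>J. if j = i then c i * c i * ?w i else 0)"
    by (intro sum.cong refl) (use orth in auto)
  also have "\<dots> = (\<Sum>i\<in>J. c i * c i * ?w i)" using \<open>finite J\<close> by simp
  \<comment> \<open>If \<open>?w i = 0\<close>, then \<open>c i = 0\<close> by the convention
    \<open>x / 0 = 0\<close>, and both terms vanish.\<close>
  also have "\<dots> = (\<Sum>i\<in>J. c i * ?a i)"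
    by (intro sum.cong refl) (auto simp: c_def)
  also have "(\<Sum>j\<in>J. c j * ?a j) = (\<Sum>j\<in>J. (?a j)\<^sup>2 / ?w j)"
    by (simp add: c_def power2_eq_square)
  finally show ?thesis by simp
qed

section \<open>Dyadic intervals and Haar functions on the line\<close>

definition dyadic :: "nat \<Rightarrow> nat \<Rightarrow> real set" where
  "dyadic j m = {real m / 2 ^ j ..< (real m + 1) / 2 ^ j}"

text \<open>The Haar function in its unnormalised form: \<open>+1\<close> on the left half of
  \<open>dyadic j m\<close>, \<open>-1\<close> on the right half. Its squared norm is therefore
  \<open>1 / 2 ^ j\<close>.\<close>

definition haar :: "nat \<Rightarrow> nat \<Rightarrow> real \<Rightarrow> real" where
  "haar j m t = indicator (dyadic (Suc j) (2 * m)) t - indicator (dyadic (Suc j) (2 * m + 1)) t"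

text \<open>Half-open intervals turn membership into an equation between integers, so that nesting
  and disjointness become statements about integer division.\<close>

lemma mem_dyadic_iff: "t \<in> dyadic j m \<longleftrightarrow> \<lfloor>2 ^ j * t\<rfloor> = int m"
  by (auto simp: dyadic_def floor_eq_iff field_simps)

lemma floor_two_power_div:
  assumes "i \<le> j"
  shows "\<lfloor>2 ^ i * (t::real)\<rfloor> = \<lfloor>2 ^ j * t\<rfloor> div 2 ^ (j - i)"
proof -
  have "(2::real) ^ j = 2 ^ i * 2 ^ (j - i)" using assms by (simp flip: power_add)
  then have "2 ^ i * t = (2 ^ j * t) / real_of_int (2 ^ (j - i))" by simp
  then show ?thesis by (metis floor_divide_real_eq_div zero_le_numeral zero_le_power)
qed

text \<open>An interval of level \<open>j' > j\<close> lies inside a single interval of level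
  \<open>Suc j\<close>, and \<open>haar j m\<close> is constant on each of those.\<close>

lemma haar_cong:
  assumes "t \<in> dyadic j' m'" "s \<in> dyadic j' m'" "j < j'"
  shows "haar j m t = haar j m s"
proof -
  have "\<lfloor>2 ^ Suc j * t\<rfloor> = \<lfloor>2 ^ Suc j * s\<rfloor>"
    using assms floor_two_power_div[of "Suc j" j'] by (simp only: mem_dyadic_iff Suc_le_eq)
  then show ?thesis by (simp only: haar_def indicator_def mem_dyadic_iff)
qed

lemma haar_square: "haar j m t * haar j m t = indicator (dyadic j m) t"
proof -
  have "\<lfloor>2 ^ j * t\<rfloor> = \<lfloor>2 ^ Suc j * t\<rfloor> div 2"
    using floor_two_power_div[of j "Suc j"] by simp
  then show ?thesis
    unfolding haar_def indicator_def mem_dyadic_iff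
    by (cases "\<lfloor>2 ^ Suc j * t\<rfloor> = int (2 * m)"; cases "\<lfloor>2 ^ Suc j * t\<rfloor> = int (2 * m + 1)")
      (simp_all only: of_bool_eq, auto)
qed

lemma haar_eq_0: "t \<notin> dyadic j m \<Longrightarrow> haar j m t = 0"
  using haar_square[of j m t] by simp

lemma dyadic_borel [measurable]: "dyadic j m \<in> sets borel"
  by (simp add: dyadic_def)

lemma haar_borel [measurable]: "haar j m \<in> borel_measurable borel"
  unfolding haar_def by measurable

lemma emeasure_dyadic: "emeasure lborel (dyadic j m) = ennreal (1 / 2 ^ j)"
  unfolding dyadic_def by (subst emeasure_lborel_Ico) (auto simp: field_simps)

lemma integrable_dyadic [simp]: "integrable lborel (indicator (dyadic j m) :: real \<Rightarrow> real)"
  by (simp add: integrable_indicator_iff emeasure_dyadic)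

lemma measure_dyadic [simp]: "measure lborel (dyadic j m) = 1 / 2 ^ j"
  by (simp add: measure_def emeasure_dyadic)

lemma integral_id_dyadic:
  shows "integrable lborel (\<lambda>t. t * indicator (dyadic j m) t :: real)"
    and "(\<integral>t. t * indicator (dyadic j m) t \<partial>lborel) = (2 * real m + 1) / (2 * (2 ^ j)\<^sup>2)"
proof -
  let ?a = "real m / 2 ^ j" and ?b = "(real m + 1) / 2 ^ j"
  have ab: "?a \<le> ?b" by (simp add: divide_right_mono)
  have h: "has_bochner_integral lborel (\<lambda>t. t * indicator {?a..?b} t) (?b\<^sup>2 / 2 - ?a\<^sup>2 / 2)"
    by (rule has_bochner_integral_FTC_Icc_real[OF ab]) (auto intro!: derivative_eq_intros)
  \<comment> \<open>The fundamental theorem of calculus gives the integral over the closed interval.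
    The half-open one differs from it only in the right endpoint.\<close>
  have "AE t in lborel. t \<noteq> ?b" by (rule AE_lborel_singleton)
  then have "AE t in lborel. t * indicator {?a..?b} t = t * indicator (dyadic j m) t"
    by eventually_elim (auto simp: dyadic_def indicator_def)
  then have "has_bochner_integral lborel (\<lambda>t. t * indicator (dyadic j m) t) (?b\<^sup>2 / 2 - ?a\<^sup>2 / 2)"
    using h by (subst has_bochner_integral_cong_AE[symmetric]) auto
  moreover have "?b\<^sup>2 / 2 - ?a\<^sup>2 / 2 = (2 * real m + 1) / (2 * (2 ^ j)\<^sup>2)"
    by (simp add: field_simps power2_eq_square)
  ultimately show "integrable lborel (\<lambda>t. t * indicator (dyadic j m) t :: real)"
    and "(\<integral>t. t * indicator (dyadic j m) t \<partial>lborel) = (2 * real m + 1) / (2 * (2 ^ j)\<^sup>2)"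
    by (auto simp: has_bochner_integral_iff)
qed

lemma integrable_haar [simp]: "integrable lborel (haar j m)"
  unfolding haar_def[abs_def] by simp

lemma integral_haar: "(\<integral>t. haar j m t \<partial>lborel) = 0"
  unfolding haar_def by (subst Bochner_Integration.integral_diff) simp_all

text \<open>On its support the Haar function is only multiplied by a constant, so its mean stays
  zero. Below, \<open>g\<close> is either a Haar function of coarser level or the indicator of a
  half-line whose endpoint lies outside the interval.\<close>

lemma
  assumes "\<And>t. t \<in> dyadic j m \<Longrightarrow> g t = (c::real)"
  shows integrable_mult_haar: "integrable lborel (\<lambda>t. g t * haar j m t)"
    and integral_mult_haar_eq_0: "(\<integral>t. g t * haar j m t \<partial>lborel) = 0"
proof -
  have *: "(\<lambda>t. g t * haar j m t) = (\<lambda>t. c * haar j m t)"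
    using assms haar_eq_0 by fastforce
  show "integrable lborel (\<lambda>t. g t * haar j m t)" "(\<integral>t. g t * haar j m t \<partial>lborel) = 0"
    unfolding * by (simp_all add: integral_haar)
qed

text \<open>The constant \<open>y\<close> drops out because the Haar function has mean zero. What
  remains is the distance \<open>1 / 2 ^ Suc j\<close> between the centres of the two halves, times
  the length \<open>1 / 2 ^ Suc j\<close> of one half.\<close>

lemma
  shows integrable_diff_mult_haar: "integrable lborel (\<lambda>t. (y - t) * haar j m t)"
    and integral_diff_mult_haar: "(\<integral>t. (y - t) * haar j m t \<partial>lborel) = 1 / (4 * 4 ^ j)"
proof -
  note [simp] = integral_id_dyadic(1)
  have *: "(\<lambda>t. (y - t) * haar j m t) = (\<lambda>t. y * haar j m t
      - (t * indicator (dyadic (Suc j) (2 * m)) t - t * indicator (dyadic (Suc j) (2 * m + 1)) t))"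
    by (auto simp: haar_def algebra_simps)
  show "integrable lborel (\<lambda>t. (y - t) * haar j m t)"
    unfolding * by simp
  have "(4::real) ^ j = (2 ^ j)\<^sup>2" by (simp add: power2_eq_square flip: power_mult_distrib)
  then show "(\<integral>t. (y - t) * haar j m t \<partial>lborel) = 1 / (4 * 4 ^ j)"
    unfolding * by (simp add: integral_haar integral_id_dyadic(2) field_simps power2_eq_square)
qed

text \<open>At different levels the coarser function is constant on the support of the finer one. At
  equal levels and different positions the supports are disjoint.\<close>

lemma
  shows integrable_haar_mult_haar: "integrable lborel (\<lambda>t. haar j m t * haar j' m' t)"
    and integral_haar_mult_haar:
      "(\<integral>t. haar j m t * haar j' m' t \<partial>lborel) = (if j = j' \<and> m = m' then 1 / 2 ^ j else 0)"
proof -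
  have lt: "integrable lborel (\<lambda>t. haar j m t * haar j' m' t)
      \<and> (\<integral>t. haar j m t * haar j' m' t \<partial>lborel) = 0"
    if "j < j'" for j m j' m'
  proof -
    have c: "real m' / 2 ^ j' \<in> dyadic j' m'" by (simp add: dyadic_def divide_right_mono divide_strict_right_mono)
    show ?thesis
      using integrable_mult_haar integral_mult_haar_eq_0 haar_cong[OF _ c that] by blast
  qed
  have disj: "(\<lambda>t. haar j m t * haar j m' t) = (\<lambda>t. 0)" if "m \<noteq> m'" for j
  proof
    show "haar j m t * haar j m' t = 0" for t
      using that haar_eq_0[of t j m] haar_eq_0[of t j m']
      by (cases "t \<in> dyadic j m") (auto simp: mem_dyadic_iff)
  qed
  have "integrable lborel (\<lambda>t. haar j m t * haar j' m' t) \<and>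
    (\<integral>t. haar j m t * haar j' m' t \<partial>lborel) = (if j = j' \<and> m = m' then 1 / 2 ^ j else 0)"
  proof (cases j j' rule: linorder_cases)
    case less
    then show ?thesis using lt by simp
  next
    case greater
    then show ?thesis using lt[OF greater, of m' m] by (simp add: mult.commute)
  next
    case equal
    show ?thesis
    proof (cases "m = m'")
      case True
      then show ?thesis unfolding equal by (simp add: haar_square)
    next
      case False
      then show ?thesis unfolding equal disj[OF False] by simp
    qed
  qed
  then show "integrable lborel (\<lambda>t. haar j m t * haar j' m' t)"
    "(\<integral>t. haar j m t * haar j' m' t \<partial>lborel) = (if j = j' \<and> m = m' then 1 / 2 ^ j else 0)"
    by auto
qed

section \<open>The discrepancy function in terms of products over the coordinates\<close>

lemma measure_half_open_box:
  fixes x y :: "real ^ 'd"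
  assumes "x \<le> y"
  shows "measure lborel (half_open_box x y) = (\<Prod>i\<in>UNIV. y $ i - x $ i)"
proof -
  have ind: "indicator (half_open_box x y) z = (\<Prod>i\<in>UNIV. indicator {x $ i..<y $ i} (z $ i) :: real)" for z
    by (auto simp: half_open_box_def indicator_def)
  have le: "x $ i \<le> y $ i" for i using assms by (simp add: less_eq_vec_def)
  have int: "integrable lborel (indicator {x $ i..<y $ i} :: real \<Rightarrow> real)" for i
    using le[of i] by (simp add: integrable_indicator_iff)
  have "measure lborel (half_open_box x y) = (\<integral>z. indicator (half_open_box x y) z \<partial>lborel)"
    by simp
  also have "\<dots> = (\<Prod>i\<in>UNIV. \<integral>t. indicator {x $ i..<y $ i} t \<partial>lborel)"
    unfolding ind by (rule integral_lborel_cart_prod) (rule int)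
  also have "\<dots> = (\<Prod>i\<in>UNIV. y $ i - x $ i)"
    by (intro prod.cong refl) (simp add: measure_def le)
  finally show ?thesis .
qed

text \<open>The discrepancy of \<open>[x,y)\<close>, written for all \<open>x\<close> and
  \<open>y\<close>, even if not \<open>x \<le> y\<close>, as a combination of products of functions
  of single coordinates. Integrals over \<open>x\<close> then factor.\<close>

definition local_disc :: "(real ^ 'd) set \<Rightarrow> real ^ 'd \<Rightarrow> real ^ 'd \<Rightarrow> real" where
  "local_disc P x y = (\<Sum>p\<in>P. \<Prod>i\<in>UNIV. indicator {..p $ i} (x $ i) * indicator {p $ i<..} (y $ i))
     - real (card P) * (\<Prod>i\<in>UNIV. y $ i - x $ i)"

lemma local_disc_eq:
  assumes "finite P" "x \<le> y"
  shows "real (count_in (half_open_box x y) P) - real (card P) * measure lborel (half_open_box x y)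
    = local_disc P x y"
proof -
  have "(\<Prod>i\<in>UNIV. indicator {..p $ i} (x $ i) * indicator {p $ i<..} (y $ i))
      = (of_bool (p \<in> half_open_box x y) :: real)" for p
    by (auto simp: half_open_box_def indicator_def)
  then show ?thesis
    using assms(1) by (simp add: local_disc_def measure_half_open_box[OF assms(2)] count_in_def
        of_bool_def sum.If_cases Int_def)
qed

lemma borel_measurable_fst_snd_vec_nth [measurable]:
  fixes i :: "'d::finite"
  shows "(\<lambda>z. fst z $ i) \<in> borel_measurable ((borel :: (real ^ 'd) measure) \<Otimes>\<^sub>M M)"
    and "(\<lambda>z. snd z $ i) \<in> borel_measurable (M \<Otimes>\<^sub>M (borel :: (real ^ 'd) measure))"
proof -
  have nth: "(\<lambda>x::real^'d. x $ i) \<in> borel_measurable borel" by measurable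
  show "(\<lambda>z. fst z $ i) \<in> borel_measurable ((borel :: (real ^ 'd) measure) \<Otimes>\<^sub>M M)"
    "(\<lambda>z. snd z $ i) \<in> borel_measurable (M \<Otimes>\<^sub>M (borel :: (real ^ 'd) measure))"
    using measurable_compose[OF measurable_fst nth] measurable_compose[OF measurable_snd nth] by auto
qed

lemma local_disc_borel [measurable]:
  "(\<lambda>z. local_disc P (fst z) (snd z)) \<in> borel_measurable (borel \<Otimes>\<^sub>M borel)"
  unfolding local_disc_def by measurable

text \<open>The counting part and the volume part both lie between \<open>0\<close> and
  \<open>card P\<close>, hence so does the absolute value of their difference. This supplies the
  integrable bounds needed later.\<close>

lemma abs_local_disc_le:
  assumes "finite P" "\<And>i. 0 \<le> x $ i" "\<And>i. x $ i \<le> y $ i" "\<And>i. y $ i \<le> 1"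
  shows "\<bar>local_disc P x y\<bar> \<le> real (card P)"
proof -
  have "(\<Prod>i\<in>UNIV. indicator {..p $ i} (x $ i) * indicator {p $ i<..} (y $ i) :: real) \<in> {0..1}" for p
    by (auto intro!: prod_nonneg prod_le_1 simp: indicator_def)
  then have "0 \<le> (\<Sum>p\<in>P. \<Prod>i\<in>UNIV. indicator {..p $ i} (x $ i) * indicator {p $ i<..} (y $ i) :: real)"
    "(\<Sum>p\<in>P. \<Prod>i\<in>UNIV. indicator {..p $ i} (x $ i) * indicator {p $ i<..} (y $ i) :: real) \<le> real (card P) * 1"
    using sum_bounded_above[of P _ "1::real"] by (auto intro!: sum_nonneg)
  moreover have "y $ i - x $ i \<in> {0..1}" for i
    using assms(2)[of i] assms(3)[of i] assms(4)[of i] by auto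
  then have "0 \<le> (\<Prod>i\<in>UNIV. y $ i - x $ i)" "(\<Prod>i\<in>UNIV. y $ i - x $ i) \<le> 1"
    by (auto intro!: prod_nonneg prod_le_1)
  then have "0 \<le> real (card P) * (\<Prod>i\<in>UNIV. y $ i - x $ i)"
    "real (card P) * (\<Prod>i\<in>UNIV. y $ i - x $ i) \<le> real (card P) * 1"
    by (intro mult_nonneg_nonneg mult_left_mono; simp)+
  ultimately show ?thesis unfolding local_disc_def by linarith
qed

section \<open>Products of Haar functions and their inner products with the discrepancy\<close>

text \<open>Here \<open>k\<close> is the shape and \<open>m\<close> the position of the supporting
  dyadic box, whose volume is \<open>1 / 2 ^ (\<Sum>i\<in>UNIV. k i)\<close>.\<close>

definition haar_prod :: "('d \<Rightarrow> nat) \<Rightarrow> ('d \<Rightarrow> nat) \<Rightarrow> real ^ 'd \<Rightarrow> real" where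
  "haar_prod k m x = (\<Prod>i\<in>UNIV. haar (k i) (m i) (x $ i))"

lemma
  fixes k m k' m' :: "'d::finite \<Rightarrow> nat"
  shows integrable_haar_prod_mult: "integrable lborel (\<lambda>x. haar_prod k m x * haar_prod k' m' x)"
    and integral_haar_prod_mult: "(\<integral>x. haar_prod k m x * haar_prod k' m' x \<partial>lborel)
      = (if k = k' \<and> m = m' then 1 / 2 ^ (\<Sum>i\<in>UNIV. k i) else 0)"
proof -
  have *: "haar_prod k m x * haar_prod k' m' x
    = (\<Prod>i\<in>UNIV. haar (k i) (m i) (x $ i) * haar (k' i) (m' i) (x $ i))" for x
    by (simp add: haar_prod_def prod.distrib)
  show "integrable lborel (\<lambda>x. haar_prod k m x * haar_prod k' m' x)"
    unfolding * by (rule integrable_lborel_cart_prod) (rule integrable_haar_mult_haar)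
  have "(\<integral>x. haar_prod k m x * haar_prod k' m' x \<partial>lborel)
      = (\<Prod>i\<in>UNIV. if k i = k' i \<and> m i = m' i then 1 / 2 ^ k i else 0)"
    unfolding *
    by (subst integral_lborel_cart_prod) (simp_all add: integrable_haar_mult_haar integral_haar_mult_haar)
  also have "\<dots> = (if k = k' \<and> m = m' then 1 / 2 ^ (\<Sum>i\<in>UNIV. k i) else 0)"
  proof (cases "k = k' \<and> m = m'")
    case True
    then show ?thesis by (simp add: prod_dividef power_sum)
  next
    case False
    then have "\<exists>i. \<not> (k i = k' i \<and> m i = m' i)" by (auto simp: fun_eq_iff)
    then show ?thesis using False by (subst if_not_P) (auto intro!: prod_zero)
  qed
  finally show "(\<integral>x. haar_prod k m x * haar_prod k' m' x \<partial>lborel)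
      = (if k = k' \<and> m = m' then 1 / 2 ^ (\<Sum>i\<in>UNIV. k i) else 0)" .
qed

lemma integrable_indicator_mult_haar:
  "A \<in> sets borel \<Longrightarrow> integrable lborel (\<lambda>t. indicator A t * haar j m t)"
  using integrable_mult_indicator[of A lborel "haar j m"] by simp

text \<open>Each point \<open>p\<close> misses the box in some coordinate \<open>i\<close>. The
  factor of the counting term in that coordinate integrates to zero, which kills the whole product.
  In the volume part each coordinate contributes \<open>1 / (4 * 4 ^ k i)\<close>, independently of
  \<open>y\<close> and \<open>m\<close>.\<close>

lemma
  fixes P :: "(real ^ 'd) set"
  assumes empty: "\<And>p. p \<in> P \<Longrightarrow> \<exists>i. p $ i \<notin> dyadic (k i) (m i)"
  shows integrable_local_disc_haar: "integrable lborel (\<lambda>x. local_disc P x y * haar_prod k m x)"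
    and integral_local_disc_haar: "(\<integral>x. local_disc P x y * haar_prod k m x \<partial>lborel)
      = - real (card P) / (4 ^ CARD('d) * 4 ^ (\<Sum>i\<in>UNIV. k i))"
proof -
  let ?h = "\<lambda>p i t. indicator {p $ i<..} (y $ i) * (indicator {..p $ i} t * haar (k i) (m i) t)"
  let ?g = "\<lambda>i t. (y $ i - t) * haar (k i) (m i) t"
  have *: "local_disc P x y * haar_prod k m x
    = (\<Sum>p\<in>P. \<Prod>i\<in>UNIV. ?h p i (x $ i)) - real (card P) * (\<Prod>i\<in>UNIV. ?g i (x $ i))" for x
    unfolding local_disc_def haar_prod_def left_diff_distrib[of "sum _ _"] sum_distrib_right
    by (simp only: prod.distrib mult_ac)
  have h: "integrable lborel (?h p i)" for p i
    by (intro integrable_mult_right integrable_indicator_mult_haar) simp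
  have h0: "(\<Prod>i\<in>UNIV. \<integral>t. ?h p i t \<partial>lborel) = 0" if "p \<in> P" for p
  proof -
    obtain i where i: "p $ i \<notin> dyadic (k i) (m i)" using empty[OF \<open>p \<in> P\<close>] by blast
    have "(\<integral>t. indicator {..p $ i} t * haar (k i) (m i) t \<partial>lborel) = 0"
    proof (rule integral_mult_haar_eq_0)
      \<comment> \<open>A point \<open>p $ i\<close> outside the interval is either to its left,
        where the indicator is \<open>0\<close> on the interval, or at or beyond its right end,
        where it is \<open>1\<close>.\<close>
      show "indicator {..p $ i} t = (of_bool ((real (m i) + 1) / 2 ^ k i \<le> p $ i) :: real)"
        if "t \<in> dyadic (k i) (m i)" for t
        using that i by (auto simp: dyadic_def indicator_def)
    qed
    then show ?thesis by (intro prod_zero) auto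
  qed
  have inth: "integrable lborel (\<lambda>x. \<Prod>i\<in>UNIV. ?h p i (x $ i))" for p
    by (rule integrable_lborel_cart_prod) (rule h)
  have intg: "integrable lborel (\<lambda>x. \<Prod>i\<in>UNIV. ?g i (x $ i))"
    by (rule integrable_lborel_cart_prod) (rule integrable_diff_mult_haar)
  show "integrable lborel (\<lambda>x. local_disc P x y * haar_prod k m x)"
    unfolding * using inth intg by simp
  have "(\<integral>x. local_disc P x y * haar_prod k m x \<partial>lborel)
    = (\<Sum>p\<in>P. \<integral>x. (\<Prod>i\<in>UNIV. ?h p i (x $ i)) \<partial>lborel)
      - real (card P) * (\<integral>x. (\<Prod>i\<in>UNIV. ?g i (x $ i)) \<partial>lborel)"
    unfolding * using inth intg by simp
  also have "(\<Sum>p\<in>P. \<integral>x. (\<Prod>i\<in>UNIV. ?h p i (x $ i)) \<partial>lborel) = 0"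
    by (intro sum.neutral ballI) (simp only: integral_lborel_cart_prod[OF h] h0)
  also have "(\<integral>x. (\<Prod>i\<in>UNIV. ?g i (x $ i)) \<partial>lborel) = (\<Prod>i\<in>UNIV. 1 / (4 * 4 ^ k i))"
    by (subst integral_lborel_cart_prod) (simp_all only: integrable_diff_mult_haar integral_diff_mult_haar)
  also have "\<dots> = 1 / (4 ^ CARD('d) * 4 ^ (\<Sum>i\<in>UNIV. k i))"
    by (simp add: prod_dividef prod.distrib power_sum)
  finally show "(\<integral>x. local_disc P x y * haar_prod k m x \<partial>lborel)
      = - real (card P) / (4 ^ CARD('d) * 4 ^ (\<Sum>i\<in>UNIV. k i))" by simp
qed

lemma haar_prod_support:
  assumes "\<And>i. real (m i) + 1 \<le> 2 ^ k i / 2" "haar_prod k m x \<noteq> 0"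
  shows "0 \<le> x $ i \<and> x $ i < 1/2"
proof -
  have "x $ i \<in> dyadic (k i) (m i)"
    using assms(2) haar_eq_0[of "x $ i" "k i" "m i"] by (auto simp: haar_prod_def)
  then have "real (m i) / 2 ^ k i \<le> x $ i" "x $ i < (real (m i) + 1) / 2 ^ k i" by (auto simp: dyadic_def)
  moreover have "(real (m i) + 1) / 2 ^ k i \<le> 1/2" using assms(1)[of i] by (simp add: field_simps)
  moreover have "0 \<le> real (m i) / 2 ^ k i" by simp
  ultimately show ?thesis by linarith
qed

section \<open>Bessel's inequality for a fixed upper corner \<open>y\<close>\<close>

text \<open>With \<open>N = card P\<close> and \<open>d = CARD('d)\<close>, each empty box
  contributes its squared coefficient \<open>(N / (4 ^ d * 4 ^ n))\<^sup>2\<close> divided by the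
  squared norm \<open>1 / 2 ^ n\<close>, that is
  \<open>N\<^sup>2 / (16 ^ d * 8 ^ n)\<close>.\<close>

lemma slice_lower_bound:
  fixes P :: "(real ^ 'd) set" and J :: "(('d \<Rightarrow> nat) \<times> ('d \<Rightarrow> nat)) set"
  defines "S \<equiv> {x :: real ^ 'd. \<forall>i. 0 \<le> x $ i \<and> x $ i < 1/2}"
  assumes "finite P" "finite J"
    and y: "\<And>i. 1/2 \<le> y $ i" "\<And>i. y $ i \<le> 1"
    and level: "\<And>k m. (k, m) \<in> J \<Longrightarrow> (\<Sum>i\<in>UNIV. k i) = n"
    and low: "\<And>k m i. (k, m) \<in> J \<Longrightarrow> real (m i) + 1 \<le> 2 ^ k i / 2"
    and empty: "\<And>k m p. (k, m) \<in> J \<Longrightarrow> p \<in> P \<Longrightarrow> \<exists>i. p $ i \<notin> dyadic (k i) (m i)"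
  shows "real (card J) * (real (card P))\<^sup>2 / (16 ^ CARD('d) * 8 ^ n)
      \<le> (\<integral>x. (indicator S x * local_disc P x y)\<^sup>2 \<partial>lborel)"
proof -
  let ?f = "\<lambda>x. indicator S x * local_disc P x y"
  let ?e = "\<lambda>j. haar_prod (fst j) (snd j)"
  have S[measurable]: "S \<in> sets borel" unfolding S_def by measurable
  have [measurable]: "(\<lambda>x. local_disc P x y) \<in> borel_measurable borel"
    unfolding local_disc_def by measurable
  \<comment> \<open>For \<open>x\<close> in \<open>S\<close>, every coordinate satisfies
    \<open>x $ i < 1/2 \<le> y $ i\<close>, so the uniform bound by \<open>card P\<close> is
    available.\<close>
  have ff: "integrable lborel (\<lambda>x. (?f x)\<^sup>2)"
  proof (rule Bochner_Integration.integrable_bound)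
    show "integrable lborel (\<lambda>x::real^'d. (real (card P))\<^sup>2 * indicator (cbox 0 1) x)"
      by (intro integrable_mult_right) (simp add: integrable_indicator_iff emeasure_lborel_cbox_eq)
    have "(?f x)\<^sup>2 \<le> (real (card P))\<^sup>2 * indicator (cbox 0 1) x" for x
    proof (cases "x \<in> S")
      case True
      then have x: "0 \<le> x $ i" "x $ i < 1/2" for i by (auto simp: S_def)
      have "\<bar>local_disc P x y\<bar> \<le> real (card P)"
      proof (rule abs_local_disc_le)
        show "x $ i \<le> y $ i" for i using x(2)[of i] y(1)[of i] by linarith
      qed (use x y \<open>finite P\<close> in auto)
      then have "(local_disc P x y)\<^sup>2 \<le> (real (card P))\<^sup>2"
        using abs_le_square_iff by fastforce
      moreover have "x $ i \<le> 1" for i using x(2)[of i] by linarith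
      then have "x \<in> cbox 0 1" using x(1) by (auto simp: mem_box_cart)
      ultimately show ?thesis using True by simp
    qed simp
    then show "AE x in lborel. norm ((?f x)\<^sup>2) \<le> norm ((real (card P))\<^sup>2 * indicator (cbox 0 1) x :: real)"
      by (intro AE_I2) simp
  qed measurable
  \<comment> \<open>The cutoff to \<open>S\<close> leaves the coefficients unchanged, since by
    \<open>low\<close> every Haar product in \<open>J\<close> vanishes outside
    \<open>S\<close>.\<close>
  have supp: "?f x * ?e j x = local_disc P x y * ?e j x" if "j \<in> J" for j x
  proof (cases "?e j x = 0")
    case False
    then have "x \<in> S"
      using haar_prod_support[of "snd j" "fst j" x] low[of "fst j" "snd j"] that by (auto simp: S_def)
    then show ?thesis by simp
  qed simp
  have coeff: "integrable lborel (\<lambda>x. ?f x * ?e j x)"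
    "(\<integral>x. ?f x * ?e j x \<partial>lborel) = - real (card P) / (4 ^ CARD('d) * 4 ^ n)" if "j \<in> J" for j
    using integrable_local_disc_haar[of P "fst j" "snd j" y] integral_local_disc_haar[of P "fst j" "snd j" y]
      empty[of "fst j" "snd j"] level[of "fst j" "snd j"] that by (simp_all add: supp[OF that])
  have norms: "(\<integral>x. ?e j x * ?e j x \<partial>lborel) = 1 / 2 ^ n" if "j \<in> J" for j
    using level[of "fst j" "snd j"] that by (simp add: integral_haar_prod_mult)
  have "(4::real) ^ n * 4 ^ n = 8 ^ n * 2 ^ n" "(4::real) ^ CARD('d) * 4 ^ CARD('d) = 16 ^ CARD('d)"
    by (simp_all flip: power_mult_distrib)
  then have "(- real (card P) / (4 ^ CARD('d) * 4 ^ n))\<^sup>2 / (1 / 2 ^ n)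
      = (real (card P))\<^sup>2 / (16 ^ CARD('d) * 8 ^ n)"
    by (simp add: power2_eq_square field_simps)
  then have "real (card J) * (real (card P))\<^sup>2 / (16 ^ CARD('d) * 8 ^ n)
      = (\<Sum>j\<in>J. (\<integral>x. ?f x * ?e j x \<partial>lborel)\<^sup>2 / (\<integral>x. ?e j x * ?e j x \<partial>lborel))"
    by (simp add: coeff norms)
  also have "\<dots> \<le> (\<integral>x. (?f x)\<^sup>2 \<partial>lborel)"
    by (rule bessel_inequality)
      (use \<open>finite J\<close> ff coeff(1) in \<open>auto simp: integrable_haar_prod_mult integral_haar_prod_mult prod_eq_iff\<close>)
  finally show ?thesis .
qed

section \<open>Counting shapes and empty boxes\<close>

text \<open>All exponents but one range freely over \<open>{..n div d}\<close>, and the remaining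
  one is determined by the sum \<open>n\<close>.\<close>

lemma card_shapes:
  fixes n :: nat
  defines "d \<equiv> CARD('d::finite)"
  shows "\<exists>K :: ('d \<Rightarrow> nat) set. finite K \<and> (\<forall>k\<in>K. (\<Sum>i\<in>UNIV. k i) = n)
    \<and> card K = (n div d + 1) ^ (d - 1)"
proof -
  obtain i0 :: 'd where True by blast
  let ?I = "UNIV - {i0}"
  let ?E = "?I \<rightarrow>\<^sub>E {..n div d}"
  \<comment> \<open>The coordinate \<open>i0\<close> takes the remainder. The truncated subtraction
    is exact on \<open>?E\<close>, because \<open>d - 1\<close> numbers of size at most
    \<open>n div d\<close> add up to at most \<open>n\<close>.\<close>
  define \<phi> where "\<phi> f = (\<lambda>i. if i = i0 then n - (\<Sum>j\<in>?I. f j) else f i)" for f :: "'d \<Rightarrow> nat"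
  have "inj_on \<phi> ?E"
  proof (rule inj_onI)
    fix f g assume fg: "f \<in> ?E" "g \<in> ?E" "\<phi> f = \<phi> g"
    show "f = g"
    proof (rule PiE_ext[OF fg(1,2)])
      show "f i = g i" if "i \<in> ?I" for i
        using fun_cong[OF fg(3), of i] that by (simp add: \<phi>_def)
    qed
  qed
  then have "card (\<phi> ` ?E) = card ?E" by (rule card_image)
  also have "\<dots> = (n div d + 1) ^ (d - 1)"
    by (simp add: card_PiE d_def card_Diff_singleton)
  finally have card: "card (\<phi> ` ?E) = (n div d + 1) ^ (d - 1)" .
  have "(\<Sum>i\<in>UNIV. \<phi> f i) = n" if f: "f \<in> ?E" for f
  proof -
    have "(\<Sum>j\<in>?I. f j) \<le> card ?I * (n div d)"
      using f by (intro sum_bounded_above[where K = "n div d", simplified]) auto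
    also have "\<dots> \<le> d * (n div d)" by (intro mult_right_mono) (auto simp: d_def card_Diff_singleton)
    also have "\<dots> \<le> n" by simp
    finally have le: "(\<Sum>j\<in>?I. f j) \<le> n" .
    have "(\<Sum>i\<in>UNIV. \<phi> f i) = \<phi> f i0 + (\<Sum>i\<in>?I. \<phi> f i)" by (simp add: sum.remove)
    also have "(\<Sum>i\<in>?I. \<phi> f i) = (\<Sum>i\<in>?I. f i)" by (intro sum.cong) (auto simp: \<phi>_def)
    finally show ?thesis using le by (simp add: \<phi>_def)
  qed
  then show ?thesis
    using card by (intro exI[of _ "\<phi> ` ?E"]) (auto intro!: finite_imageI finite_PiE)
qed

text \<open>Pigeonhole: boxes of one shape are disjoint, so each point occupies at most one of them.
  The ranges \<open>b\<close> of the positions are kept apart from the levels \<open>k\<close>, so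
  that only part of the cube may be covered.\<close>

lemma card_empty_boxes:
  fixes P :: "(real ^ 'd) set" and k :: "'d \<Rightarrow> nat" and b :: "'d \<Rightarrow> nat"
  assumes "finite P"
  shows "(\<Prod>i\<in>UNIV. b i) \<le> card P
    + card {m. (\<forall>i. m i < b i) \<and> (\<forall>p\<in>P. \<exists>i. p $ i \<notin> dyadic (k i) (m i))}"
    and "finite {m. (\<forall>i. m i < b i) \<and> (\<forall>p\<in>P. \<exists>i. p $ i \<notin> dyadic (k i) (m i))}" (is "finite ?E")
proof -
  let ?A = "{m. \<forall>i. m i < b i}"
  let ?\<phi> = "\<lambda>p i. nat \<lfloor>2 ^ k i * p $ i\<rfloor>"
  have A: "?A = PiE UNIV (\<lambda>i. {..<b i})" by (auto simp: PiE_UNIV_domain)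
  have "finite ?A" unfolding A by (intro finite_PiE) auto
  then show fin: "finite ?E" by (rule rev_finite_subset) auto
  have "?A \<subseteq> ?\<phi> ` P \<union> ?E"
  proof
    fix m assume m: "m \<in> ?A"
    show "m \<in> ?\<phi> ` P \<union> ?E"
    proof (cases "m \<in> ?E")
      case False
      then obtain p where "p \<in> P" "\<And>i. p $ i \<in> dyadic (k i) (m i)" using m by auto
      \<comment> \<open>Each floor equals \<open>int (m i)\<close> here, so \<open>nat\<close> loses
        nothing.\<close>
      then have "m = ?\<phi> p" by (auto simp: mem_dyadic_iff)
      then show ?thesis using \<open>p \<in> P\<close> by blast
    qed simp
  qed
  then have "card ?A \<le> card (?\<phi> ` P \<union> ?E)" using fin \<open>finite P\<close> by (intro card_mono) auto
  also have "\<dots> \<le> card (?\<phi> ` P) + card ?E" by (rule card_Un_le)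
  also have "\<dots> \<le> card P + card ?E" using card_image_le[OF \<open>finite P\<close>] by simp
  finally show "(\<Prod>i\<in>UNIV. b i) \<le> card P + card ?E" by (simp add: A card_PiE)
qed

text \<open>Each shape of total level \<open>n\<close> is refined by one level per coordinate, which
  adds \<open>CARD('d)\<close> to the total. It then has \<open>2 ^ n\<close> boxes in
  \<open>[0,1/2)\<^sup>d\<close>, at most half of them occupied since
  \<open>2 * card P \<le> 2 ^ n\<close>.\<close>

lemma empty_dyadic_boxes:
  fixes P :: "(real ^ 'd) set"
  assumes "finite P" and n: "2 * card P \<le> 2 ^ n"
  shows "\<exists>J :: (('d \<Rightarrow> nat) \<times> ('d \<Rightarrow> nat)) set. finite J
    \<and> (\<forall>(k, m)\<in>J. (\<Sum>i\<in>UNIV. k i) = n + CARD('d) \<and> (\<forall>i. real (m i) + 1 \<le> 2 ^ k i / 2)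
        \<and> (\<forall>p\<in>P. \<exists>i. p $ i \<notin> dyadic (k i) (m i)))
    \<and> (real n / CARD('d)) ^ (CARD('d) - 1) * 2 ^ n / 2 \<le> real (card J)"
proof -
  obtain K :: "('d \<Rightarrow> nat) set" where K: "finite K" "\<And>k. k \<in> K \<Longrightarrow> (\<Sum>i\<in>UNIV. k i) = n"
    "card K = (n div CARD('d) + 1) ^ (CARD('d) - 1)"
    using card_shapes[where 'd='d, of n] by blast
  let ?E = "\<lambda>k. {m. (\<forall>i. m i < 2 ^ k i) \<and> (\<forall>p\<in>P. \<exists>i. p $ i \<notin> dyadic (Suc (k i)) (m i))}"
  \<comment> \<open>At level \<open>Suc (k i)\<close> the indices \<open>m i < 2 ^ k i\<close> are those of the intervals in \<open>[0,1/2)\<close>.\<close>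
  let ?J = "(\<lambda>(k, m). (\<lambda>i. Suc (k i), m)) ` (SIGMA k:K. ?E k)"
  have inj: "inj (\<lambda>(k :: 'd \<Rightarrow> nat, m :: 'd \<Rightarrow> nat). (\<lambda>i. Suc (k i), m))"
    by (auto simp: inj_def fun_eq_iff)
  have fin: "finite (?E k)" for k
    using card_empty_boxes(2)[OF \<open>finite P\<close>, of "\<lambda>i. 2 ^ k i" "\<lambda>i. Suc (k i)"] by simp
  have half: "2 ^ n \<le> 2 * card (?E k)" if "k \<in> K" for k
    using card_empty_boxes(1)[OF \<open>finite P\<close>, of "\<lambda>i. 2 ^ k i" "\<lambda>i. Suc (k i)"] n K(2)[OF that]
    by (simp flip: power_sum)
  \<comment> \<open>Replaces the rounded quotient from \<open>card_shapes\<close> by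
    \<open>n / d\<close>.\<close>
  have "real n < real CARD('d) * (real (n div CARD('d)) + 1)"
    using dividend_less_times_div[of "CARD('d)" n]
    by (metis mult_Suc_right of_nat_Suc of_nat_less_iff of_nat_mult zero_less_card_finite add.commute)
  then have "real n / CARD('d) \<le> real (n div CARD('d) + 1)" by (simp add: field_simps)
  then have "(real n / CARD('d)) ^ (CARD('d) - 1) \<le> real (card K)"
    unfolding K(3) of_nat_power by (intro power_mono) auto
  then have "(real n / CARD('d)) ^ (CARD('d) - 1) * 2 ^ n / 2 \<le> real (card K) * (2 ^ n / 2)"
    by simp
  also have "\<dots> = (\<Sum>k\<in>K. 2 ^ n / 2)" by simp
  also have "\<dots> \<le> (\<Sum>k\<in>K. real (card (?E k)))"
  proof (rule sum_mono)
    fix k assume "k \<in> K"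
    have "real (2 ^ n) \<le> real (2 * card (?E k))" using half[OF \<open>k \<in> K\<close>] by (rule of_nat_mono)
    then show "2 ^ n / 2 \<le> real (card (?E k))" by simp
  qed
  also have "\<dots> = real (card ?J)"
    using K(1) fin by (simp add: card_image inj_on_subset[OF inj])
  finally have "(real n / CARD('d)) ^ (CARD('d) - 1) * 2 ^ n / 2 \<le> real (card ?J)" .
  moreover have "finite ?J" using K(1) fin by auto
  moreover have "\<forall>(k, m)\<in>?J. (\<Sum>i\<in>UNIV. k i) = n + CARD('d) \<and> (\<forall>i. real (m i) + 1 \<le> 2 ^ k i / 2)
        \<and> (\<forall>p\<in>P. \<exists>i. p $ i \<notin> dyadic (k i) (m i))"
  proof -
    have "real a * 2 + 2 \<le> 2 * 2 ^ b" if "a < 2 ^ b" for a b :: nat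
    proof -
      have "real (Suc a) \<le> real (2 ^ b)" using that by (intro of_nat_mono Suc_leI)
      then show ?thesis by simp
    qed
    then show ?thesis
      using K(2) by (auto simp: sum_Suc)
  qed
  ultimately show ?thesis by blast
qed

section \<open>Choice of the level and integration over the upper corner\<close>

text \<open>The level \<open>n\<close> is chosen with \<open>2 * N \<le> 2 ^ n \<le> 4 * N\<close>:
  the first inequality leaves half of the boxes empty, the second gives
  \<open>N\<^sup>2 / 4 ^ n \<ge> 1 / 16\<close>. In the constant, \<open>32\<close> is
  \<open>2 * 16\<close> from these two losses, and \<open>128\<close> is \<open>16 * 8\<close>, the
  \<open>8\<close> coming from the \<open>d\<close> additional levels.\<close>

lemma slice_log_bound:
  fixes P :: "(real ^ 'd) set"
  defines "S \<equiv> {x :: real ^ 'd. \<forall>i. 0 \<le> x $ i \<and> x $ i < 1/2}"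
  assumes "finite P" "P \<noteq> {}"
    and y: "\<And>i. 1/2 \<le> y $ i" "\<And>i. y $ i \<le> 1"
  shows "(1 + ln (real (card P))) ^ (CARD('d) - 1) / (32 * 128 ^ CARD('d) * CARD('d) ^ (CARD('d) - 1))
      \<le> (\<integral>x. (indicator S x * local_disc P x y)\<^sup>2 \<partial>lborel)"
proof -
  let ?d = "CARD('d)" and ?N = "card P"
  have N: "?N \<ge> 1" using assms(2,3) by (simp add: Suc_le_eq card_gt_0_iff)
  obtain n0 where n0: "2 ^ n0 \<le> ?N" "?N < 2 ^ (n0 + 1)"
    using ex_power_ivl1[of 2 ?N] N by auto
  define n where "n = n0 + 2"
  have n: "2 * ?N \<le> 2 ^ n" "2 ^ n \<le> 4 * ?N" using n0 by (auto simp: n_def)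
  obtain J :: "(('d \<Rightarrow> nat) \<times> ('d \<Rightarrow> nat)) set" where J: "finite J"
    "\<forall>(k, m)\<in>J. (\<Sum>i\<in>UNIV. k i) = n + ?d \<and> (\<forall>i. real (m i) + 1 \<le> 2 ^ k i / 2)
        \<and> (\<forall>p\<in>P. \<exists>i. p $ i \<notin> dyadic (k i) (m i))"
    "(real n / ?d) ^ (?d - 1) * 2 ^ n / 2 \<le> real (card J)"
    using empty_dyadic_boxes[OF \<open>finite P\<close> n(1)] by blast
  \<comment> \<open>The exponent \<open>n - 1\<close> together with \<open>ln 2 < 1\<close> leaves
    room for the summand \<open>1\<close> in \<open>1 + ln N \<le> n\<close>.\<close>
  have "real ?N \<le> 2 ^ (n - 1)" using n0(2) by (simp add: n_def) (metis less_imp_le of_nat_le_iff of_nat_numeral of_nat_power power_Suc of_nat_mult)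
  then have "ln (real ?N) \<le> ln (2 ^ (n - 1))" using N by simp
  also have "\<dots> = real (n - 1) * ln 2" by (simp add: ln_realpow)
  also have "\<dots> \<le> real (n - 1) * 1" using ln_2_less_1 by (intro mult_left_mono) auto
  finally have ln: "1 + ln (real ?N) \<le> real n" by (simp add: n_def)
  have ln0: "0 \<le> ln (real ?N)" using N by simp
  have sq: "(2 ^ n)\<^sup>2 \<le> 16 * (real ?N)\<^sup>2"
  proof -
    have "(2::real) ^ n \<le> 4 * real ?N" using n(2) by (metis of_nat_le_iff of_nat_mult of_nat_numeral of_nat_power)
    then have "(2 ^ n)\<^sup>2 \<le> (4 * real ?N)\<^sup>2" by (rule power_mono) simp
    then show ?thesis by (simp add: power_mult_distrib)
  qed
  have eight: "(8::real) ^ n = 2 ^ n * (2 ^ n)\<^sup>2" by (simp add: power2_eq_square flip: power_mult_distrib)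
  have "(1 + ln (real ?N)) ^ (?d - 1) / (32 * 128 ^ ?d * ?d ^ (?d - 1))
      = ((1 + ln (real ?N)) / ?d) ^ (?d - 1) / (32 * 128 ^ ?d)"
    by (simp add: power_divide)
  also have "\<dots> \<le> (real n / ?d) ^ (?d - 1) / (32 * 128 ^ ?d)"
    using ln ln0 by (intro divide_right_mono power_mono) auto
  also have "\<dots> = (real n / ?d) ^ (?d - 1) * 2 ^ n / 2 * ((2 ^ n)\<^sup>2 / 16) / (128 ^ ?d * 8 ^ n)"
    unfolding eight by (simp add: field_simps)
  also have "\<dots> \<le> real (card J) * (real ?N)\<^sup>2 / (128 ^ ?d * 8 ^ n)"
    using J(3) sq by (intro divide_right_mono mult_mono) auto
  also have "\<dots> = real (card J) * (real ?N)\<^sup>2 / (16 ^ ?d * 8 ^ (n + ?d))"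
    by (simp add: power_add mult_ac flip: power_mult_distrib)
  also have "\<dots> \<le> (\<integral>x. (indicator S x * local_disc P x y)\<^sup>2 \<partial>lborel)"
    unfolding S_def by (rule slice_lower_bound) (use assms J in auto)
  finally show ?thesis .
qed

text \<open>The integrand is nonnegative, so the domain may be reduced to \<open>y\<close> in
  \<open>[1/2,1]\<^sup>d\<close> and \<open>x\<close> in \<open>[0,1/2)\<^sup>d\<close>, where
  \<open>x \<le> y\<close> holds automatically. The factor \<open>1 / 2 ^ CARD('d)\<close> is the
  volume of the range of \<open>y\<close>.\<close>

lemma extreme_L2_discrepancy_lower_bound:
  fixes P :: "(real ^ 'd) set"
  assumes "finite P" "0 \<le> C"
    and slice: "\<And>y :: real ^ 'd. (\<And>i. 1/2 \<le> y $ i) \<Longrightarrow> (\<And>i. y $ i \<le> 1) \<Longrightarrow>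
      C \<le> (\<integral>x. (indicator {x. \<forall>i. 0 \<le> x $ i \<and> x $ i < 1/2} x * local_disc P x y)\<^sup>2 \<partial>lborel)"
  shows "sqrt (C / 2 ^ CARD('d)) \<le> extreme_L2_discrepancy P"
proof -
  let ?S = "{x :: real ^ 'd. \<forall>i. 0 \<le> x $ i \<and> x $ i < 1/2}"
  let ?Y = "cbox (\<chi> i. 1/2) 1 :: (real ^ 'd) set"
  let ?D = "\<lambda>x y. \<bar>real (count_in (half_open_box x y) P)
     - real (card P) * measure lborel (half_open_box x y)\<bar>\<^sup>2"
  \<comment> \<open>The domain of the double integral as one set of pairs makes \<open>h\<close>
    jointly measurable, from which measurability of the inner integral \<open>H\<close>
    follows.\<close>
  define T where "T = {z :: (real ^ 'd) \<times> (real ^ 'd). (\<forall>i. 0 \<le> fst z $ i \<and> fst z $ i \<le> snd z $ i \<and> snd z $ i \<le> 1)}"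
  define h where "h z = indicator T z * (local_disc P (fst z) (snd z))\<^sup>2" for z
  have [measurable]: "T \<in> sets (borel \<Otimes>\<^sub>M borel)"
  proof -
    have "{z \<in> space (borel \<Otimes>\<^sub>M borel). \<forall>i::'d. 0 \<le> fst z $ i \<and> fst z $ i \<le> snd z $ i \<and> snd z $ i \<le> 1}
      \<in> sets (borel \<Otimes>\<^sub>M (borel :: (real ^ 'd) measure))" by measurable
    then show ?thesis by (simp add: T_def space_pair_measure)
  qed
  have h_meas[measurable]: "h \<in> borel_measurable (borel \<Otimes>\<^sub>M borel)"
    unfolding h_def by measurable
  have h0: "0 \<le> h z" for z by (simp add: h_def)
  have h_le: "h z \<le> (real (card P))\<^sup>2 * indicator (cbox 0 1) (fst z)" for z
  proof (cases "z \<in> T")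
    case True
    then have z: "0 \<le> fst z $ i" "fst z $ i \<le> snd z $ i" "snd z $ i \<le> 1" for i by (auto simp: T_def)
    have "\<bar>local_disc P (fst z) (snd z)\<bar> \<le> real (card P)"
      by (rule abs_local_disc_le) (use z \<open>finite P\<close> in auto)
    then have "(local_disc P (fst z) (snd z))\<^sup>2 \<le> (real (card P))\<^sup>2"
      using abs_le_square_iff by fastforce
    moreover have "fst z \<in> cbox 0 1" using z order_trans[OF z(2) z(3)] by (auto simp: mem_box_cart)
    ultimately show ?thesis using True by (simp add: h_def)
  qed (simp add: h_def)
  have box: "integrable lborel (\<lambda>x::real^'d. (real (card P))\<^sup>2 * indicator (cbox 0 1) x)"
    by (intro integrable_mult_right) (simp add: integrable_indicator_iff emeasure_lborel_cbox_eq)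
  have h_slice_meas[measurable]: "(\<lambda>x. h (x, y)) \<in> borel_measurable borel" for y
    by measurable
  have int_h: "integrable lborel (\<lambda>x. h (x, y))" for y
    by (rule Bochner_Integration.integrable_bound[OF box]) (use h0 h_le[of "(_, y)"] in auto)
  define H where "H y = (\<integral>x. h (x, y) \<partial>lborel)" for y
  have H_meas[measurable]: "H \<in> borel_measurable borel"
    unfolding H_def by measurable
  have H0: "0 \<le> H y" for y unfolding H_def using h0 by simp
  have H_le: "H y \<le> (real (card P))\<^sup>2" for y
  proof -
    have "H y \<le> (\<integral>x. (real (card P))\<^sup>2 * indicator (cbox 0 1) x \<partial>(lborel :: (real ^ 'd) measure))"
      unfolding H_def by (rule integral_mono[OF int_h box]) (use h_le[of "(_, y)"] in simp)
    also have "measure lborel (cbox 0 1 :: (real ^ 'd) set) = 1"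
      by (subst content_cbox_cart) (auto simp: interval_ne_empty_cart)
    then have "(\<integral>x. (real (card P))\<^sup>2 * indicator (cbox 0 1) x \<partial>(lborel :: (real ^ 'd) measure)) = (real (card P))\<^sup>2"
      by simp
    finally show ?thesis .
  qed
  have inner: "(LBINT x:{x \<in> cbox 0 1. x \<le> y}. ?D x y) = H y" if "y \<in> cbox 0 1" for y
    unfolding H_def set_lebesgue_integral_def
  proof (rule Bochner_Integration.integral_cong[OF refl])
    fix x :: "real ^ 'd"
    show "indicator {x \<in> cbox 0 1. x \<le> y} x *\<^sub>R ?D x y = h (x, y)"
    proof (cases "x \<in> cbox 0 1 \<and> x \<le> y")
      case True
      then have "(x, y) \<in> T" using that by (auto simp: T_def mem_box_cart less_eq_vec_def)
      then show ?thesis using True local_disc_eq[OF \<open>finite P\<close>, of x y] by (simp add: h_def)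
    next
      case False
      moreover have "x $ i \<le> 1" if "(x, y) \<in> T" for i
        using that by (auto simp: T_def intro: order_trans)
      ultimately have "(x, y) \<notin> T" by (auto simp: T_def mem_box_cart less_eq_vec_def)
      then show ?thesis using False by (auto simp: h_def)
    qed
  qed
  have HC: "C * indicator ?Y y \<le> indicator (cbox 0 1) y * H y" for y
  proof (cases "y \<in> ?Y")
    case True
    then have y: "1/2 \<le> y $ i" "y $ i \<le> 1" for i by (auto simp: mem_box_cart)
    have "0 \<le> y $ i" for i using y(1)[of i] by linarith
    then have "y \<in> cbox 0 1" using y by (auto simp: mem_box_cart)
    have eq: "(indicator ?S x * local_disc P x y)\<^sup>2 \<le> h (x, y)" for x
    proof (cases "x \<in> ?S")
      case True
      then have x: "0 \<le> x $ i" "x $ i < 1/2" for i by auto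
      have "x $ i \<le> y $ i" for i using x(2)[of i] y(1)[of i] by linarith
      then have "(x, y) \<in> T" using x y by (auto simp: T_def)
      then show ?thesis using True by (simp add: h_def)
    qed (use h0 in simp)
    have "C \<le> (\<integral>x. (indicator ?S x * local_disc P x y)\<^sup>2 \<partial>lborel)" using slice y by blast
    also have "\<dots> \<le> H y"
      unfolding H_def by (rule Bochner_Integration.integral_mono'[OF int_h eq]) (rule h0)
    finally show ?thesis using True \<open>y \<in> cbox 0 1\<close> by simp
  qed (use H0 in simp)
  \<comment> \<open>A nonintegrable function has Bochner integral \<open>0\<close>, so the
    comparison with the constant \<open>C\<close> on \<open>?Y\<close> requires integrability of the
    larger function.\<close>
  have int_H: "integrable lborel (\<lambda>y. indicator (cbox 0 1) y * H y)"
  proof (rule Bochner_Integration.integrable_bound[OF box])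
    have "norm (indicator (cbox 0 1) y * H y) \<le> norm ((real (card P))\<^sup>2 * indicator (cbox 0 1) y :: real)" for y
      using H0[of y] H_le[of y] by (cases "y \<in> cbox 0 1") simp_all
    then show "AE y in lborel. norm (indicator (cbox 0 1) y * H y)
        \<le> norm ((real (card P))\<^sup>2 * indicator (cbox 0 1) y :: real)" by (rule AE_I2)
  qed measurable
  have Y: "measure lborel ?Y = 1 / 2 ^ CARD('d)"
    by (subst content_cbox_cart) (auto simp: interval_ne_empty_cart power_divide)
  have "C / 2 ^ CARD('d) = (\<integral>y. C * indicator ?Y y \<partial>lborel)" by (simp add: Y)
  also have "\<dots> \<le> (\<integral>y. indicator (cbox 0 1) y * H y \<partial>lborel)"
    by (rule integral_mono[OF _ int_H HC]) (simp add: integrable_indicator_iff emeasure_lborel_cbox_eq)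
  also have "\<dots> = (LBINT y:cbox 0 1. LBINT x:{x \<in> cbox 0 1. x \<le> y}. ?D x y)"
    unfolding set_lebesgue_integral_def[of _ "cbox 0 1"]
  proof (rule Bochner_Integration.integral_cong[OF refl])
    show "indicator (cbox 0 1) y * H y
      = indicator (cbox 0 1) y *\<^sub>R (LBINT x:{x \<in> cbox 0 1. x \<le> y}. ?D x y)" for y
    proof (cases "y \<in> cbox 0 1")
      case True
      show ?thesis unfolding inner[OF True] by simp
    qed simp
  qed
  finally show ?thesis unfolding extreme_L2_discrepancy_def by (rule real_sqrt_le_mono)
qed

theorem theorem6:
  shows "\<exists>c::real. c > 0 \<and>
    (\<forall>(N::nat) (P::(real ^ 'd) set).
       N \<ge> 1 \<longrightarrow> finite P \<longrightarrow> card P = N \<longrightarrow> P \<subseteq> half_open_box 0 1 \<longrightarrow>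
       extreme_L2_discrepancy P \<ge> c * (1 + ln (real N)) powr ((real CARD('d) - 1) / 2))"
proof (intro exI conjI allI impI)
  let ?d = "CARD('d)"
  \<comment> \<open>The base \<open>256\<close> is \<open>128 * 2\<close>, combining the bound for a
    single \<open>y\<close> with the volume of the range of \<open>y\<close>. The witness is
    \<open>sqrt c\<close>, as the discrepancy is a square root.\<close>
  define c where "c = 1 / (32 * 256 ^ ?d * real ?d ^ (?d - 1))"
  have "c > 0" by (simp add: c_def)
  then show "sqrt c > 0" by simp
  fix N :: nat and P :: "(real ^ 'd) set"
  assume P: "N \<ge> 1" "finite P" "card P = N" "P \<subseteq> half_open_box 0 1"
  then have "P \<noteq> {}" by auto
  let ?L = "1 + ln (real N)"
  have L: "?L > 0" using P(1) by (simp add: add_pos_nonneg)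
  let ?C = "?L ^ (?d - 1) / (32 * 128 ^ ?d * real ?d ^ (?d - 1))"
  \<comment> \<open>Since \<open>?d \<ge> 1\<close>, the real difference \<open>real ?d - 1\<close>
    agrees with the natural number \<open>?d - 1\<close>.\<close>
  have "?L powr ((real ?d - 1) / 2) = sqrt (?L ^ (?d - 1))"
    using L by (simp add: powr_half_sqrt[symmetric] powr_powr powr_realpow[symmetric])
  then have "sqrt c * ?L powr ((real ?d - 1) / 2) = sqrt (c * ?L ^ (?d - 1))"
    by (simp add: real_sqrt_mult)
  also have "c * ?L ^ (?d - 1) = ?C / 2 ^ ?d"
    using power_mult_distrib[of "128::real" 2 ?d] by (simp add: c_def)
  also have "sqrt (?C / 2 ^ ?d) \<le> extreme_L2_discrepancy P"
  proof (rule extreme_L2_discrepancy_lower_bound)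
    show "0 \<le> ?C" using L by simp
    fix y :: "real ^ 'd"
    assume y: "\<And>i. 1/2 \<le> y $ i" "\<And>i. y $ i \<le> 1"
    show "?C \<le> (\<integral>x. (indicator {x. \<forall>i. 0 \<le> x $ i \<and> x $ i < 1/2} x * local_disc P x y)\<^sup>2 \<partial>lborel)"
      using slice_log_bound[OF P(2) \<open>P \<noteq> {}\<close> y] P(3) by simp
  qed (use P in auto)
  finally show "extreme_L2_discrepancy P \<ge> sqrt c * ?L powr ((real ?d - 1) / 2)" .
qed

end
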